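(* Let $K\subset\mathbb{R}^2$ be a convex body, normalized so that $\operatorname{area}(K)=1$, possessing an orientation-reversing affine automorphism, i.e. there is an affine map $A(x)=Lx+b$ with $\det L<0$ and $A(K)=K$. Then for every $0<t\le 1/4$ there are two Euclidean-perpendicular lines cutting $K$ into four pieces whose areas, in cyclic order, are $$t,\quad t,\quad \tfrac12-t,\quad \tfrac12-t .$$
   Context: A convex body is a compact convex set with nonempty interior. The pieces are the intersections of $K$ with the four quadrant-shaped regions determined by the two perpendicular lines, listed in cyclic order around the intersection point of the lines. The automorphism is not assumed to be an involution. *)

theory Defs
  imports "HOL-Analysis.Analysis"
begin

definition convex_body :: "'a::euclidean_space set \<Rightarrow> bool" where
  "convex_body K \<longleftrightarrow> compact K \<and> convex K \<and> interior K \<noteq> {}"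

definition area :: "(real^2) set \<Rightarrow> real" where
  "area S = measure lebesgue S"

definition line :: "real^2 \<Rightarrow> real^2 \<Rightarrow> (real^2) set" where
  "line p u = {p + s *\<^sub>R u | s. True}"

definition quadrant :: "real^2 \<Rightarrow> real^2 \<Rightarrow> real^2 \<Rightarrow> (real^2) set" where
  "quadrant p u v = {p + r *\<^sub>R u + s *\<^sub>R v | r s. 0 \<le> r \<and> 0 \<le> s}"

(* The lines l and m are perpendicular, and Qs lists the four closed regions they determine
   in cyclic order around their common point p.  The pair (u, v) may have either orientation
   and u, v may be replaced by their negatives, so every starting region is allowed, and both
   the clockwise and the counterclockwise order (l and m may be interchanged in the
   existential use of this predicate). *)
definition perpendicular_lines_quadrants ::
    "(real^2) set \<Rightarrow> (real^2) set \<Rightarrow> (real^2) set list \<Rightarrow> bool" where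
  "perpendicular_lines_quadrants l m Qs \<longleftrightarrow>
     (\<exists>p u v. u \<noteq> 0 \<and> v \<noteq> 0 \<and> u \<bullet> v = 0 \<and> l = line p u \<and> m = line p v \<and>
        Qs = [quadrant p u v, quadrant p (-u) v, quadrant p (-u) (-v), quadrant p u (-v)])"

end

theory Submission
  imports Defs
begin

text \<open>
  For a direction \<open>u\<close> let \<open>f u\<close> be the area of the first quadrant cut from \<open>K\<close> by the bisecting line
  with normal \<open>u\<close> and the perpendicular line that cuts off area \<open>2t\<close>; the other three areas are then
  \<open>2t - f u\<close>, \<open>1/2 - 2t + f u\<close> and \<open>1/2 - f u\<close>, so it suffices to find \<open>u\<close> with \<open>f u = t\<close>.
  An affine map does not preserve perpendicularity, but some perpendicular pair \<open>u, v\<close> is mapped by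
  \<open>L\<close> to a perpendicular pair (singular vectors). As \<open>L\<close> reverses orientation, the automorphism
  exchanges the roles of the two quadrants of total area \<open>2t\<close>, so \<open>f (- L u) = 2t - f u\<close>, and the
  intermediate value theorem on the punctured plane applies.
\<close>

section \<open>Half-spaces and the continuous dependence of the measures they cut off\<close>

definition halfspace :: "'a::real_inner \<Rightarrow> real \<Rightarrow> 'a set" where
  "halfspace n c = {x. c \<le> n \<bullet> x}"

lemma closed_halfspace [simp]: "closed (halfspace n c)"
  unfolding halfspace_def by (rule closed_halfspace_ge)

lemma halfspace_scaleR: "0 < a \<Longrightarrow> halfspace (a *\<^sub>R n) (a * c) = halfspace n c"
  by (simp add: halfspace_def)

lemma lmeasurable_Int_closed:
  fixes K :: "'a::euclidean_space set"
  shows "K \<in> lmeasurable \<Longrightarrow> closed S \<Longrightarrow> K \<inter> S \<in> lmeasurable"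
  by (simp add: fmeasurable_Int_fmeasurable)

lemma measure_Un_disjoint:
  assumes "S \<in> lmeasurable" "T \<in> lmeasurable" "S \<inter> T = {}"
  shows "measure lebesgue S + measure lebesgue T = measure lebesgue (S \<union> T)"
  using measure_Un3_negligible[of S T "{}" "S \<union> T"] assms by simp

text \<open>The two closed halves overlap only in the hyperplane \<open>n \<bullet> x = c\<close>,
  which is negligible as \<open>n\<close> is nonzero.\<close>

lemma measure_split_halfspace:
  fixes S :: "'a::euclidean_space set"
  assumes "S \<in> lmeasurable" "n \<noteq> 0"
  shows "measure lebesgue (S \<inter> halfspace n c) + measure lebesgue (S \<inter> halfspace (- n) (- c))
    = measure lebesgue S"
proof -
  have neg: "negligible (S \<inter> halfspace n c \<inter> (S \<inter> halfspace (- n) (- c)))"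
    by (rule negligible_subset[OF negligible_hyperplane[of n c]])
      (use assms in \<open>auto simp: halfspace_def\<close>)
  have S: "S \<inter> halfspace n c \<union> S \<inter> halfspace (- n) (- c) = S"
    by (auto simp: halfspace_def)
  show ?thesis
    using measure_Un3_negligible[of "S \<inter> halfspace n c" "S \<inter> halfspace (- n) (- c)" "{}" S]
      lmeasurable_Int_closed[OF assms(1) closed_halfspace] neg S by simp
qed

text \<open>Dominated convergence along sequences: off the null set \<open>N\<close> the indicators
  are eventually constant, and the integrable indicator of \<open>K\<close> bounds them all.\<close>

lemma measure_Int_tendsto:
  fixes S :: "'b::metric_space \<Rightarrow> 'a::euclidean_space set"
  assumes K: "K \<in> lmeasurable" and S: "\<And>y. S y \<in> sets lebesgue"
    and N: "negligible N"
    and ev: "\<And>x. x \<notin> N \<Longrightarrow> \<forall>\<^sub>F y in at y0 within D. x \<in> S y \<longleftrightarrow> x \<in> S y0"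
  shows "((\<lambda>y. measure lebesgue (K \<inter> S y)) \<longlongrightarrow> measure lebesgue (K \<inter> S y0)) (at y0 within D)"
  unfolding tendsto_at_iff_sequentially o_def
proof (intro allI impI)
  fix X :: "nat \<Rightarrow> 'b"
  assume X: "\<forall>i. X i \<in> D - {y0}" "X \<longlonglongrightarrow> y0"
  then have lim: "filterlim X (at y0 within D) sequentially"
    by (auto simp: filterlim_at)
  have "(\<lambda>i. integral\<^sup>L lebesgue (indicator (K \<inter> S (X i)) :: 'a \<Rightarrow> real))
      \<longlonglongrightarrow> integral\<^sup>L lebesgue (indicator (K \<inter> S y0))"
  proof (rule integral_dominated_convergence[where w = "indicator K"])
    show "AE x in lebesgue.
        (\<lambda>i. indicator (K \<inter> S (X i)) x :: real) \<longlonglongrightarrow> indicator (K \<inter> S y0) x"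
    proof (rule AE_I')
      show "N \<in> null_sets lebesgue"
        using N by (simp add: negligible_iff_null_sets)
      show "{x \<in> space lebesgue.
        \<not> (\<lambda>i. indicator (K \<inter> S (X i)) x :: real) \<longlonglongrightarrow> indicator (K \<inter> S y0) x} \<subseteq> N"
      proof (rule ccontr)
        assume "\<not> ?thesis"
        then obtain x where x: "x \<notin> N"
          "\<not> (\<lambda>i. indicator (K \<inter> S (X i)) x :: real) \<longlonglongrightarrow> indicator (K \<inter> S y0) x"
          by auto
        have "\<forall>\<^sub>F i in sequentially. x \<in> S (X i) \<longleftrightarrow> x \<in> S y0"
          using filterlim_iff[THEN iffD1, OF lim] ev[OF x(1)] by blast
        then have "(\<lambda>i. indicator (K \<inter> S (X i)) x :: real) \<longlonglongrightarrow> indicator (K \<inter> S y0) x"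
          by (intro tendsto_eventually) (auto elim!: eventually_mono simp: indicator_def)
        with x show False by blast
      qed
    qed
  qed (use K S in \<open>auto simp: fmeasurable_def indicator_def\<close>)
  then show "(\<lambda>i. measure lebesgue (K \<inter> S (X i))) \<longlonglongrightarrow> measure lebesgue (K \<inter> S y0)"
    by simp
qed

text \<open>Off the boundary hyperplane the relevant inequality is strict, so it persists for nearby
  parameters. Boundary points form the exceptional null set in the continuity proofs.\<close>

lemma halfspace_eventually:
  fixes n :: "'b::metric_space \<Rightarrow> 'a::euclidean_space"
  assumes "continuous (at y0 within D) n" "continuous (at y0 within D) a" "n y0 \<bullet> x \<noteq> a y0"
  shows "\<forall>\<^sub>F y in at y0 within D. x \<in> halfspace (n y) (a y) \<longleftrightarrow> x \<in> halfspace (n y0) (a y0)"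
proof -
  have lim: "((\<lambda>y. n y \<bullet> x - a y) \<longlongrightarrow> n y0 \<bullet> x - a y0) (at y0 within D)"
    using assms by (auto simp: continuous_within intro!: tendsto_intros)
  consider "n y0 \<bullet> x - a y0 > 0" | "n y0 \<bullet> x - a y0 < 0"
    using assms(3) by linarith
  then show ?thesis
  proof cases
    case 1
    then show ?thesis
      using order_tendstoD(1)[OF lim 1] by (auto elim!: eventually_mono simp: halfspace_def)
  next
    case 2
    then show ?thesis
      using order_tendstoD(2)[OF lim 2] by (auto elim!: eventually_mono simp: halfspace_def)
  qed
qed

text \<open>Two half-spaces are treated together because a quadrant is such an intersection; the
  exceptional null set consists of the two boundary hyperplanes.\<close>

lemma continuous_on_measure_halfspace2:
  fixes n m :: "'b::metric_space \<Rightarrow> 'a::euclidean_space"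
  assumes K: "K \<in> lmeasurable"
    and cont: "continuous_on D n" "continuous_on D a" "continuous_on D m" "continuous_on D b"
    and nz: "\<And>y. y \<in> D \<Longrightarrow> n y \<noteq> 0" "\<And>y. y \<in> D \<Longrightarrow> m y \<noteq> 0"
  shows "continuous_on D
    (\<lambda>y. measure lebesgue (K \<inter> (halfspace (n y) (a y) \<inter> halfspace (m y) (b y))))"
  unfolding continuous_on_def
proof
  fix y0 assume y0: "y0 \<in> D"
  let ?N = "{x. n y0 \<bullet> x = a y0} \<union> {x. m y0 \<bullet> x = b y0}"
  show "((\<lambda>y. measure lebesgue (K \<inter> (halfspace (n y) (a y) \<inter> halfspace (m y) (b y)))) \<longlongrightarrow>
     measure lebesgue (K \<inter> (halfspace (n y0) (a y0) \<inter> halfspace (m y0) (b y0)))) (at y0 within D)"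
  proof (rule measure_Int_tendsto[OF K])
    show "negligible ?N"
      using nz[OF y0] by (intro negligible_Un negligible_hyperplane) auto
    fix x assume "x \<notin> ?N"
    then show "\<forall>\<^sub>F y in at y0 within D.
      x \<in> halfspace (n y) (a y) \<inter> halfspace (m y) (b y) \<longleftrightarrow>
      x \<in> halfspace (n y0) (a y0) \<inter> halfspace (m y0) (b y0)"
      using halfspace_eventually[of y0 D n a x] halfspace_eventually[of y0 D m b x] cont y0
      by (auto simp: continuous_on_eq_continuous_within elim: eventually_elim2)
  qed auto
qed

lemma continuous_on_measure_halfspace:
  fixes n :: "'b::metric_space \<Rightarrow> 'a::euclidean_space"
  assumes "K \<in> lmeasurable" "continuous_on D n" "continuous_on D a"
    and "\<And>y. y \<in> D \<Longrightarrow> n y \<noteq> 0"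
  shows "continuous_on D (\<lambda>y. measure lebesgue (K \<inter> halfspace (n y) (a y)))"
  \<comment> \<open>Both half-spaces are taken to be the same one.\<close>
  using continuous_on_measure_halfspace2[OF assms(1-3) assms(2-4) assms(4)] by simp

section \<open>The level at which a half-space cuts off a prescribed measure\<close>

lemma convex_body_lmeasurable: "convex_body K \<Longrightarrow> K \<in> lmeasurable"
  by (simp add: convex_body_def lmeasurable_compact)

text \<open>The last two assumptions put points of \<open>K\<close> on both sides of the slab
  between the levels \<open>c\<close> and \<open>c'\<close>. By connectedness \<open>K\<close> then
  meets the open slab, and it does so in a set of positive measure.\<close>

lemma measure_halfspace_strict_antimono:
  fixes K :: "'a::euclidean_space set"
  assumes K: "convex_body K" and "n \<noteq> 0" "c < c'"
    and pos: "0 < measure lebesgue (K \<inter> halfspace n c')"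
    and less: "measure lebesgue (K \<inter> halfspace n c) < measure lebesgue K"
  shows "measure lebesgue (K \<inter> halfspace n c') < measure lebesgue (K \<inter> halfspace n c)"
proof -
  note lm = convex_body_lmeasurable[OF K]
  obtain x where x: "x \<in> K" "c' \<le> n \<bullet> x"
  proof -
    have "K \<inter> halfspace n c' \<noteq> {}"
      using pos by (metis measure_empty less_irrefl)
    then show ?thesis
      using that unfolding halfspace_def by blast
  qed
  obtain y where y: "y \<in> K" "n \<bullet> y < c"
  proof -
    have "\<not> K \<subseteq> halfspace n c"
      using less by (metis inf.absorb1 less_irrefl)
    then show ?thesis
      using that unfolding halfspace_def not_le[symmetric] by blast
  qed
  have "connected ((\<bullet>) n ` K)"
    using K by (intro connected_continuous_image linear_continuous_on bounded_linear_inner_right)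
      (simp add: convex_body_def convex_connected)
  moreover have "n \<bullet> y \<in> (\<bullet>) n ` K" "n \<bullet> x \<in> (\<bullet>) n ` K"
    using x y by blast+
  moreover have "n \<bullet> y \<le> (c + c') / 2" "(c + c') / 2 \<le> n \<bullet> x"
    using x y \<open>c < c'\<close> by simp_all
  ultimately have "(c + c') / 2 \<in> (\<bullet>) n ` K"
    by (rule connectedD_interval)
  then obtain z where "z \<in> K" "(c + c') / 2 = n \<bullet> z"
    by (rule imageE)
  then have z: "z \<in> K" "c < n \<bullet> z" "n \<bullet> z < c'"
    using \<open>c < c'\<close> by simp_all
  let ?T = "{x. c < n \<bullet> x} \<inter> {x. n \<bullet> x < c'}"
  have "open ?T"
    by (intro open_Int open_halfspace_gt open_halfspace_lt)
  \<comment> \<open>The point \<open>z\<close> may lie on the boundary of \<open>K\<close>, but a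
    convex body is contained in the closure of its interior, so the open slab also contains interior
    points.\<close>
  moreover have "z \<in> closure (interior K)"
    using K z(1) closure_subset[of K] convex_closure_interior[of K]
    by (auto simp: convex_body_def)
  ultimately have "?T \<inter> interior K \<noteq> {}"
    using z open_Int_closure_eq_empty[of ?T "interior K"] by auto
  moreover have T: "open (?T \<inter> interior K)" "?T \<inter> interior K \<in> lmeasurable"
  proof -
    show "open (?T \<inter> interior K)"
      using \<open>open ?T\<close> by auto
    then show "?T \<inter> interior K \<in> lmeasurable"
      using lm interior_subset[of K]
      by (intro lmeasurable_open bounded_subset[of K "?T \<inter> interior K"])
        (use K in \<open>auto simp: convex_body_def compact_imp_bounded\<close>)
  qed
  ultimately have "\<not> negligible (?T \<inter> interior K)"
    by (intro open_not_negligible)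
  then have "measure lebesgue (?T \<inter> interior K) \<noteq> 0"
    using negligible_iff_measure0[OF T(2)] by blast
  then have "0 < measure lebesgue (?T \<inter> interior K)"
    by (rule zero_less_measure_iff[THEN iffD2])
  moreover have "?T \<inter> interior K \<inter> (K \<inter> halfspace n c') = {}"
    by (auto simp: halfspace_def)
  then have "measure lebesgue (?T \<inter> interior K) + measure lebesgue (K \<inter> halfspace n c')
      = measure lebesgue (?T \<inter> interior K \<union> (K \<inter> halfspace n c'))"
    by (rule measure_Un_disjoint[OF T(2) lmeasurable_Int_closed[OF lm closed_halfspace]])
  moreover have "\<dots> \<le> measure lebesgue (K \<inter> halfspace n c)"
  proof (rule measure_mono_fmeasurable)
    show "?T \<inter> interior K \<union> (K \<inter> halfspace n c') \<subseteq> K \<inter> halfspace n c"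
      using \<open>c < c'\<close> interior_subset[of K] by (auto simp: halfspace_def)
    have "?T \<inter> interior K \<union> (K \<inter> halfspace n c') \<in> lmeasurable"
      by (rule fmeasurable.Un[OF T(2) lmeasurable_Int_closed[OF lm closed_halfspace]])
    then show "?T \<inter> interior K \<union> (K \<inter> halfspace n c') \<in> sets lebesgue"
      by (rule fmeasurableD)
    show "K \<inter> halfspace n c \<in> lmeasurable"
      by (rule lmeasurable_Int_closed[OF lm closed_halfspace])
  qed
  ultimately show ?thesis by linarith
qed

text \<open>The choice is harmless for a convex body, nonzero \<open>n\<close> and
  \<open>0 < s < measure lebesgue K\<close>, where the level is unique.\<close>

definition cutoff :: "'a::euclidean_space set \<Rightarrow> real \<Rightarrow> 'a \<Rightarrow> real" where
  "cutoff K s n = (SOME c. measure lebesgue (K \<inter> halfspace n c) = s)"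

lemma measure_cutoff:
  fixes K :: "'a::euclidean_space set"
  assumes K: "convex_body K" and n: "n \<noteq> 0" and s: "0 \<le> s" "s \<le> measure lebesgue K"
  shows "measure lebesgue (K \<inter> halfspace n (cutoff K s n)) = s"
proof -
  note lm = convex_body_lmeasurable[OF K]
  obtain B where B: "0 < B" "\<And>x. x \<in> K \<Longrightarrow> norm x \<le> B"
    using K unfolding convex_body_def by (meson bounded_pos compact_imp_bounded)
  have bnd: "\<bar>n \<bullet> x\<bar> \<le> norm n * B" if "x \<in> K" for x
    using Cauchy_Schwarz_ineq2[of n x] B(2)[OF that] mult_left_mono[of "norm x" B "norm n"]
    by simp
  \<comment> \<open>At level \<open>?a\<close> the half-space contains all of \<open>K\<close>. The
    added 1 puts \<open>?b\<close> strictly above every value of \<open>n \<bullet> x\<close> on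
    \<open>K\<close>, so the half-space there misses \<open>K\<close>.\<close>
  let ?a = "- (norm n * B)" and ?b = "norm n * B + 1"
  have "0 \<le> norm n * B" using B by simp
  have "K \<inter> halfspace n ?a = K" "K \<inter> halfspace n ?b = {}"
    using bnd by (force simp: halfspace_def abs_le_iff)+
  moreover have "?a \<le> ?b"
    using \<open>0 \<le> norm n * B\<close> by linarith
  ultimately have "\<exists>c\<ge>?a. c \<le> ?b \<and> measure lebesgue (K \<inter> halfspace n c) = s"
    using s n lm
    by (intro IVT2' continuous_on_measure_halfspace continuous_intros) auto
  then show ?thesis
    unfolding cutoff_def by (metis (mono_tags, lifting) someI_ex)
qed

text \<open>This replaces inequalities for the implicitly defined level by inequalities for a
  measure at a fixed level, which is known to be continuous in \<open>n\<close>.\<close>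

lemma less_cutoff_iff:
  fixes K :: "'a::euclidean_space set"
  assumes K: "convex_body K" and n: "n \<noteq> 0" and s: "0 < s" "s < measure lebesgue K"
  shows "c < cutoff K s n \<longleftrightarrow> s < measure lebesgue (K \<inter> halfspace n c)"
    and "cutoff K s n < c \<longleftrightarrow> measure lebesgue (K \<inter> halfspace n c) < s"
proof -
  note lm = convex_body_lmeasurable[OF K]
  have cut: "measure lebesgue (K \<inter> halfspace n (cutoff K s n)) = s"
    using measure_cutoff[OF K n] s by simp
  \<comment> \<open>Strict monotonicity needs the section to be neither all of \<open>K\<close> in
    measure nor null. In those excluded cases \<open>s < measure lebesgue K\<close>, respectively
    \<open>0 < s\<close>, gives the claim directly.\<close>
  have le: "c < cutoff K s n \<Longrightarrow> s < measure lebesgue (K \<inter> halfspace n c)"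
    using measure_halfspace_strict_antimono[OF K n, of c "cutoff K s n"] cut s by linarith
  have ge: "cutoff K s n < c \<Longrightarrow> measure lebesgue (K \<inter> halfspace n c) < s"
    using measure_halfspace_strict_antimono[OF K n, of "cutoff K s n" c] cut s
    by (smt (verit) measure_nonneg)
  show "c < cutoff K s n \<longleftrightarrow> s < measure lebesgue (K \<inter> halfspace n c)"
    and "cutoff K s n < c \<longleftrightarrow> measure lebesgue (K \<inter> halfspace n c) < s"
    using le ge cut by (metis less_asym less_irrefl linorder_less_linear)+
qed

lemma cutoff_unique:
  fixes K :: "'a::euclidean_space set"
  assumes "convex_body K" "n \<noteq> 0" "0 < s" "s < measure lebesgue K"
    and "measure lebesgue (K \<inter> halfspace n c) = s"
  shows "cutoff K s n = c"
  using less_cutoff_iff[OF assms(1-4), of c] assms(5) by linarith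

text \<open>Continuity is checked in the order topology: each strict bound on the level at
  \<open>n0\<close> is a strict bound on a measure continuous in \<open>n\<close>, hence holds
  nearby.\<close>

lemma continuous_on_cutoff:
  fixes K :: "'a::euclidean_space set"
  assumes K: "convex_body K" and s: "0 < s" "s < measure lebesgue K"
  shows "continuous_on (- {0}) (cutoff K s)"
  unfolding continuous_on_def
proof (intro ballI order_tendstoI)
  fix n0 :: 'a and c assume n0: "n0 \<in> - {0}"
  let ?\<mu> = "\<lambda>n. measure lebesgue (K \<inter> halfspace n c)"
  have nz: "\<forall>\<^sub>F n in at n0 within - {0}. n \<noteq> 0"
    by (auto simp: eventually_at_filter)
  have lim: "(?\<mu> \<longlongrightarrow> ?\<mu> n0) (at n0 within - {0})"
    using continuous_on_measure_halfspace[OF convex_body_lmeasurable[OF K],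
        of "- {0}" "\<lambda>n. n" "\<lambda>_. c"] n0
    by (auto simp: continuous_on_def)
  show "\<forall>\<^sub>F n in at n0 within - {0}. c < cutoff K s n" if "c < cutoff K s n0"
    using eventually_conj[OF order_tendstoD(1)[OF lim, of s] nz] that n0
    by (auto simp: less_cutoff_iff[OF K _ s] elim!: eventually_mono)
  show "\<forall>\<^sub>F n in at n0 within - {0}. cutoff K s n < c" if "cutoff K s n0 < c"
    using eventually_conj[OF order_tendstoD(2)[OF lim, of s] nz] that n0
    by (auto simp: less_cutoff_iff[OF K _ s] elim!: eventually_mono)
qed

section \<open>The quarter turn and orthogonality in the plane\<close>

definition rot90 :: "real^2 \<Rightarrow> real^2" where
  "rot90 x = vector [- x $ 2, x $ 1]"

lemma rot90_nth [simp]: "rot90 x $ 1 = - x $ 2" "rot90 x $ 2 = x $ 1"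
  by (simp_all add: rot90_def)

lemma linear_rot90: "linear rot90"
  by (rule linearI) (simp_all add: vec_eq_iff forall_2)

lemma inner_2: "(x::real^2) \<bullet> y = x $ 1 * y $ 1 + x $ 2 * y $ 2"
  by (simp add: inner_vec_def sum_2)

lemma rot90_rot90 [simp]: "rot90 (rot90 x) = - x"
  by (simp add: vec_eq_iff forall_2)

lemma rot90_minus [simp]: "rot90 (- x) = - rot90 x"
  by (simp add: vec_eq_iff forall_2)

lemma rot90_eq_0_iff [simp]: "rot90 x = 0 \<longleftrightarrow> x = 0"
  by (auto simp: vec_eq_iff forall_2)

lemma inner_rot90_self [simp]: "x \<bullet> rot90 x = 0" "rot90 x \<bullet> x = 0"
  by (simp_all add: inner_2)

lemma continuous_on_rot90 [continuous_intros]: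
  "continuous_on S f \<Longrightarrow> continuous_on S (\<lambda>x. rot90 (f x))"
  using bounded_linear.continuous_on[of rot90] linear_rot90
  by (simp add: linear_conv_bounded_linear)

text \<open>In the plane the orthogonal complement of \<open>u\<close> is the line spanned by
  \<open>rot90 u\<close>. The explicit coefficient is kept because its sign records the orientation
  of the pair \<open>u\<close>, \<open>v\<close>.\<close>

lemma orthogonal_imp_scaleR_rot90:
  assumes "u \<noteq> 0" "u \<bullet> v = 0"
  shows "v = ((rot90 u \<bullet> v) / (u \<bullet> u)) *\<^sub>R rot90 u"
proof -
  have "u \<bullet> u \<noteq> 0" using assms by simp
  have "(u \<bullet> u) *\<^sub>R v = (rot90 u \<bullet> v) *\<^sub>R rot90 u + (u \<bullet> v) *\<^sub>R u"
    by (simp add: vec_eq_iff forall_2 inner_2 algebra_simps)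
  then have "(u \<bullet> u) *\<^sub>R v = (rot90 u \<bullet> v) *\<^sub>R rot90 u"
    using assms by simp
  then have "(1 / (u \<bullet> u)) *\<^sub>R (u \<bullet> u) *\<^sub>R v = (1 / (u \<bullet> u)) *\<^sub>R (rot90 u \<bullet> v) *\<^sub>R rot90 u"
    by simp
  then show ?thesis
    using \<open>u \<bullet> u \<noteq> 0\<close> by simp
qed

lemma quadrant_eq_halfspaces:
  fixes u :: "real^2"
  assumes u: "u \<noteq> 0" and v: "v \<noteq> 0" and orth: "u \<bullet> v = 0"
  shows "quadrant p u v = halfspace u (u \<bullet> p) \<inter> halfspace v (v \<bullet> p)"
proof (intro equalityI subsetI)
  fix x assume "x \<in> quadrant p u v"
  then show "x \<in> halfspace u (u \<bullet> p) \<inter> halfspace v (v \<bullet> p)"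
    using orth by (auto simp: quadrant_def halfspace_def inner_simps inner_commute[of v u])
next
  fix x assume x: "x \<in> halfspace u (u \<bullet> p) \<inter> halfspace v (v \<bullet> p)"
  define r where "r = u \<bullet> (x - p) / (u \<bullet> u)"
  define s where "s = v \<bullet> (x - p) / (v \<bullet> v)"
  \<comment> \<open>The remainder after projecting \<open>x - p\<close> onto \<open>u\<close> and
    \<open>v\<close>. It is orthogonal to both, so it vanishes in dimension two.\<close>
  define z where "z = x - p - r *\<^sub>R u - s *\<^sub>R v"
  have "u \<bullet> z = 0" "v \<bullet> z = 0"
    using u v orth by (simp_all add: z_def r_def s_def inner_simps inner_commute[of v u])
  define k l where "k = (rot90 u \<bullet> z) / (u \<bullet> u)" and "l = (rot90 u \<bullet> v) / (u \<bullet> u)"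
  have zv: "z = k *\<^sub>R rot90 u" "v = l *\<^sub>R rot90 u"
    unfolding k_def l_def by (intro orthogonal_imp_scaleR_rot90 u orth \<open>u \<bullet> z = 0\<close>)+
  have "l * k * (u \<bullet> u) = 0" "l \<noteq> 0"
    using \<open>v \<bullet> z = 0\<close> v by (auto simp: zv inner_2 algebra_simps)
  then have "z = 0"
    using u zv(1) by simp
  then have "x = p + r *\<^sub>R u + s *\<^sub>R v"
    by (simp add: z_def algebra_simps)
  moreover have "0 \<le> r" "0 \<le> s"
    using x by (auto simp: r_def s_def halfspace_def inner_simps)
  ultimately show "x \<in> quadrant p u v"
    unfolding quadrant_def by blast
qed

section \<open>Affine images and perpendicular pairs\<close>

lemma quadrant_affine_image:
  fixes L :: "real^2^2"
  shows "(\<lambda>x. L *v x + b) ` quadrant p u v = quadrant (L *v p + b) (L *v u) (L *v v)"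
proof -
  have eq: "L *v (p + r *\<^sub>R u + s *\<^sub>R v) + b
      = L *v p + b + r *\<^sub>R (L *v u) + s *\<^sub>R (L *v v)" for r s
    by (simp add: matrix_vector_right_distrib matrix_vector_mult_scaleR)
  show ?thesis
    unfolding quadrant_def eq[symmetric] by blast
qed

lemma matrix_vector_mult_minus_right:
  fixes L :: "real^'n^'m"
  shows "L *v (- x) = - (L *v x)"
  using matrix_vector_mult_scaleR[of L "-1" x] by simp

lemma measure_affine_image:
  fixes L :: "real^'n::{finite,wellorder}^'n::{finite,wellorder}"
  assumes "S \<in> lmeasurable"
  shows "measure lebesgue ((\<lambda>x. L *v x + b) ` S) = \<bar>det L\<bar> * measure lebesgue S"
proof -
  have "(\<lambda>x. L *v x + b) ` S = (+) b ` ((*v) L ` S)"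
    by (auto simp: add.commute image_image)
  then show ?thesis
    using assms by (simp add: measure_translation measure_linear_image)
qed

text \<open>The inner product below changes sign when \<open>u\<close> is replaced by \<open>rot90 u\<close>.\<close>

lemma exists_orthogonal_pair_orthogonal_image:
  fixes L :: "real^2^2"
  obtains u where "u \<noteq> 0" "(L *v u) \<bullet> (L *v rot90 u) = 0"
proof -
  define g where "g u = (L *v u) \<bullet> (L *v rot90 u)" for u
  have conn: "connected (g ` (- {0}))"
    unfolding g_def
    by (intro connected_continuous_image connected_punctured_universe continuous_intros
        linear_continuous_on_compose[OF _ matrix_vector_mul_linear]) auto
  define e :: "real^2" where "e = axis 1 1"
  have e: "e \<noteq> 0" by (simp add: e_def)
  have "g (rot90 e) = - g e"
    by (simp add: g_def inner_commute matrix_vector_mult_minus_right)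
  moreover have "g e \<in> g ` (- {0})" "g (rot90 e) \<in> g ` (- {0})"
    using e by auto
  ultimately have "0 \<in> g ` (- {0})"
    using connectedD_interval[OF conn, of "g e" "g (rot90 e)" 0]
      connectedD_interval[OF conn, of "g (rot90 e)" "g e" 0]
    by linarith
  then obtain u where "u \<in> - {0}" "0 = g u"
    by (rule imageE)
  then show ?thesis
    using that[of u] by (simp add: g_def)
qed

text \<open>The expression \<open>rot90 x \<bullet> y\<close> is the oriented area spanned by
  \<open>x\<close> and \<open>y\<close>; the pair \<open>u\<close>, \<open>rot90 u\<close> has
  oriented area \<open>u \<bullet> u\<close>, and \<open>L\<close> multiplies it by
  \<open>det L\<close>.\<close>

lemma det_eq_inner_rot90:
  fixes L :: "real^2^2"
  shows "det L * (u \<bullet> u) = rot90 (L *v u) \<bullet> (L *v rot90 u)"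
  by (simp add: det_2 inner_2 matrix_vector_mult_def sum_2 algebra_simps)

section \<open>Areas of the four quadrants\<close>

lemma exists_point_inner_rot90:
  fixes u :: "real^2"
  assumes "u \<noteq> 0"
  obtains p where "u \<bullet> p = c" "rot90 u \<bullet> p = d"
proof
  define p where "p = (c / (u \<bullet> u)) *\<^sub>R u + (d / (u \<bullet> u)) *\<^sub>R rot90 u"
  have "rot90 u \<bullet> rot90 u = u \<bullet> u"
    by (simp add: inner_2)
  then show "u \<bullet> p = c" "rot90 u \<bullet> p = d"
    using assms by (simp_all add: p_def inner_simps)
qed

lemma area_quadrants:
  assumes K: "K \<in> lmeasurable" and uv: "u \<noteq> 0" "v \<noteq> 0" "u \<bullet> v = 0"
  shows "area (K \<inter> quadrant p u v) + area (K \<inter> quadrant p (- u) v) = area (K \<inter> halfspace v (v \<bullet> p))"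
    and "area (K \<inter> quadrant p u v) + area (K \<inter> quadrant p u (- v)) = area (K \<inter> halfspace u (u \<bullet> p))"
proof -
  have "K \<inter> halfspace v (v \<bullet> p) \<in> lmeasurable" "K \<inter> halfspace u (u \<bullet> p) \<in> lmeasurable"
    using K by (auto intro: lmeasurable_Int_closed)
  from measure_split_halfspace[OF this(1), of u "u \<bullet> p"]
    measure_split_halfspace[OF this(2), of v "v \<bullet> p"]
  show "area (K \<inter> quadrant p u v) + area (K \<inter> quadrant p (- u) v) = area (K \<inter> halfspace v (v \<bullet> p))"
    and "area (K \<inter> quadrant p u v) + area (K \<inter> quadrant p u (- v)) = area (K \<inter> halfspace u (u \<bullet> p))"
    using uv by (simp_all add: area_def quadrant_eq_halfspaces Int_ac)
qed

text \<open>Mapping \<open>K\<close>, of area 1, onto itself forces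
  \<open>\<bar>det L\<bar> = 1\<close>, so the automorphism preserves area. Being injective, it
  carries the part of \<open>K\<close> in a quadrant onto the part in the image quadrant.\<close>

lemma area_affine_image_quadrant:
  fixes L :: "real^2^2"
  assumes K: "convex_body K" "area K = 1" and A: "det L < 0" "(\<lambda>x. L *v x + b) ` K = K"
    and uv: "u \<noteq> 0" "v \<noteq> 0" "u \<bullet> v = 0"
  shows "area (K \<inter> quadrant (L *v p + b) (L *v u) (L *v v)) = area (K \<inter> quadrant p u v)"
proof -
  note lm = convex_body_lmeasurable[OF K(1)]
  have "invertible L"
    using A(1) by (simp add: invertible_det_nz)
  then have inj: "inj (\<lambda>x. L *v x + b)"
    by (auto simp: inj_def dest: inj_matrix_vector_mult[THEN injD])
  have "\<bar>det L\<bar> = 1"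
    using measure_affine_image[OF lm, of L b] A(2) K(2) by (simp add: area_def)
  moreover have "(\<lambda>x. L *v x + b) ` (K \<inter> quadrant p u v)
      = K \<inter> quadrant (L *v p + b) (L *v u) (L *v v)"
    by (simp add: image_Int[OF inj] A(2) quadrant_affine_image)
  moreover have "K \<inter> quadrant p u v \<in> lmeasurable"
    using lm uv by (auto simp: quadrant_eq_halfspaces intro!: lmeasurable_Int_closed)
  ultimately show ?thesis
    using measure_affine_image[of "K \<inter> quadrant p u v" L b] by (simp add: area_def)
qed

theorem corollary7p1:
  fixes K :: "(real^2) set" and L :: "real^2^2" and b :: "real^2" and t :: real
  assumes "convex_body K"
    and "area K = 1"
    and "det L < 0"
    and "(\<lambda>x. L *v x + b) ` K = K"
    and "0 < t" and "t \<le> 1/4"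
  shows "\<exists>l m Qs. perpendicular_lines_quadrants l m Qs \<and>
           map (\<lambda>Q. area (K \<inter> Q)) Qs = [t, t, 1/2 - t, 1/2 - t]"
proof -
  note K = assms(1) and lm = convex_body_lmeasurable[OF assms(1)]
  have area1: "measure lebesgue K = 1"
    using assms(2) by (simp add: area_def)
  define c where "c = cutoff K (1/2)"
  define d where "d = cutoff K (2 * t)"
  define f where "f u = area (K \<inter> (halfspace u (c u) \<inter> halfspace (rot90 u) (d (rot90 u))))" for u
  have cont: "continuous_on (- {0}) c" "continuous_on (- {0}) d"
    unfolding c_def d_def using assms area1 by (auto intro!: continuous_on_cutoff)
  have "continuous_on (- {0}) (\<lambda>u. d (rot90 u))"
    by (rule continuous_on_compose2[OF cont(2)]) (auto intro: continuous_intros)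
  then have cont_f: "continuous_on (- {0}) f"
    unfolding f_def area_def using lm cont
    by (intro continuous_on_measure_halfspace2) (auto intro: continuous_intros)

  \<comment> \<open>The point \<open>p\<close> is where the bisecting line with normal
    \<open>u\<close> meets the perpendicular line cutting off area \<open>2 * t\<close>.\<close>
  have ex_p: "\<exists>p. area (K \<inter> halfspace u (u \<bullet> p)) = 1/2
      \<and> area (K \<inter> halfspace (rot90 u) (rot90 u \<bullet> p)) = 2 * t
      \<and> f u = area (K \<inter> quadrant p u (rot90 u))" if u: "u \<noteq> 0" for u
  proof -
    obtain p where p: "u \<bullet> p = c u" "rot90 u \<bullet> p = d (rot90 u)"
      using exists_point_inner_rot90[OF u] by blast
    then show ?thesis
      using u assms area1 measure_cutoff[OF K, of u "1/2"] measure_cutoff[OF K, of "rot90 u" "2 * t"]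
      by (intro exI[of _ p]) (simp add: f_def quadrant_eq_halfspaces area_def c_def d_def)
  qed

  obtain u where u: "u \<noteq> 0" "(L *v u) \<bullet> (L *v rot90 u) = 0"
    by (rule exists_orthogonal_pair_orthogonal_image)
  obtain p where p: "area (K \<inter> halfspace u (u \<bullet> p)) = 1/2"
      "area (K \<inter> halfspace (rot90 u) (rot90 u \<bullet> p)) = 2 * t"
      "f u = area (K \<inter> quadrant p u (rot90 u))"
    using ex_p[OF u(1)] by blast
  \<comment> \<open>Since \<open>L\<close> reverses orientation, the sign in \<open>u'\<close> makes
    the pair \<open>u'\<close>, \<open>v'\<close> positively oriented, like \<open>u\<close>,
    \<open>rot90 u\<close>.\<close>
  define u' v' p' where "u' = - (L *v u)" and "v' = L *v rot90 u" and "p' = L *v p + b"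
  have inv: "invertible L"
    using assms(3) by (simp add: invertible_det_nz)
  have nz: "u' \<noteq> 0" "v' \<noteq> 0"
    using u(1) inj_matrix_vector_mult[OF inv] unfolding u'_def v'_def
    by (metis matrix_vector_mult_0_right injD neg_equal_0_iff_equal rot90_eq_0_iff)+
  have orth: "u' \<bullet> v' = 0"
    using u(2) by (simp add: u'_def v'_def)
  define a where "a = (rot90 u' \<bullet> v') / (u' \<bullet> u')"
  have v': "v' = a *\<^sub>R rot90 u'"
    unfolding a_def by (rule orthogonal_imp_scaleR_rot90[OF nz(1) orth])
  have "rot90 u' \<bullet> v' = - (det L * (u \<bullet> u))"
    by (simp add: u'_def v'_def det_eq_inner_rot90)
  also have "\<dots> > 0"
    using assms(3) u(1) by (simp add: mult_neg_pos)
  \<comment> \<open>Positivity ensures that \<open>v'\<close> and \<open>rot90 u'\<close> define the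
    same half-spaces, not opposite ones.\<close>
  finally have "a > 0"
    using nz by (simp add: a_def)

  \<comment> \<open>Because of the sign in \<open>u'\<close>, the first quadrant for
    \<open>u'\<close>, \<open>v'\<close> is the image of the second quadrant for \<open>u\<close>,
    \<open>rot90 u\<close>, and vice versa.\<close>
  have q: "area (K \<inter> quadrant p' (- u') v') = area (K \<inter> quadrant p u (rot90 u))"
      "area (K \<inter> quadrant p' u' v') = area (K \<inter> quadrant p (- u) (rot90 u))"
      "area (K \<inter> quadrant p' u' (- v')) = area (K \<inter> quadrant p (- u) (- rot90 u))"
    using u(1) area_affine_image_quadrant[OF assms(1-4), of u "rot90 u" p]
      area_affine_image_quadrant[OF assms(1-4), of "- u" "rot90 u" p]
      area_affine_image_quadrant[OF assms(1-4), of "- u" "- rot90 u" p]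
    by (simp_all add: u'_def v'_def p'_def matrix_vector_mult_minus_right)
  \<comment> \<open>The half-space is the union of the images of the first two quadrants, so its
    area is unchanged. Uniqueness of the level then puts \<open>p'\<close> on the line that defines
    \<open>f u'\<close>.\<close>
  have "area (K \<inter> halfspace v' (v' \<bullet> p')) = 2 * t"
    using area_quadrants(1)[OF lm nz orth, of p'] area_quadrants(1)[OF lm, of u "rot90 u" p] u p q
    by simp
  then have d': "d (rot90 u') = rot90 u' \<bullet> p'"
    using nz assms area1 \<open>a > 0\<close> unfolding d_def
    by (intro cutoff_unique[OF K]) (auto simp: v' area_def halfspace_scaleR)
  \<comment> \<open>Bisection is essential here: the half-space of \<open>u'\<close> is the image of
    that of \<open>- u\<close>, and both sides of the line have area 1/2.\<close>
  have "area (K \<inter> halfspace (- u) (- u \<bullet> p)) = 1/2"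
    using measure_split_halfspace[OF lm u(1), of "u \<bullet> p"] p(1) area1 by (simp add: area_def)
  then have "area (K \<inter> halfspace u' (u' \<bullet> p')) = 1/2"
    using area_quadrants(2)[OF lm nz orth, of p'] area_quadrants(2)[OF lm, of "- u" "rot90 u" p] u q
    by simp
  then have c': "c u' = u' \<bullet> p'"
    using nz assms area1 unfolding c_def by (intro cutoff_unique[OF K]) (auto simp: area_def)
  have "f u' = area (K \<inter> quadrant p' u' v')"
    using quadrant_eq_halfspaces[OF nz orth] \<open>a > 0\<close> by (simp add: f_def c' d' v' halfspace_scaleR)
  also have "\<dots> = 2 * t - f u"
    using q p area_quadrants(1)[OF lm, of u "rot90 u" p] u by simp
  finally have f': "f u' = 2 * t - f u" .

  have conn: "connected (f ` (- {0}))"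
    by (intro connected_continuous_image connected_punctured_universe cont_f) simp
  have "f u \<in> f ` (- {0})" "f u' \<in> f ` (- {0})"
    using u(1) nz(1) by auto
  \<comment> \<open>The values \<open>f u\<close> and \<open>2 * t - f u\<close> have mean
    \<open>t\<close>, so \<open>t\<close> lies between them.\<close>
  then have "t \<in> f ` (- {0})"
    using connectedD_interval[OF conn, of "f u" "f u'" t]
      connectedD_interval[OF conn, of "f u'" "f u" t] f'
    by linarith
  then obtain w where w: "w \<noteq> 0" "f w = t"
    by auto
  obtain r where r: "area (K \<inter> halfspace w (w \<bullet> r)) = 1/2"
      "area (K \<inter> halfspace (rot90 w) (rot90 w \<bullet> r)) = 2 * t"
      "area (K \<inter> quadrant r w (rot90 w)) = t"
    using ex_p[OF w(1)] w(2) by metis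
  have "area (K \<inter> halfspace (- w) (- w \<bullet> r)) = 1/2"
    using measure_split_halfspace[OF lm w(1), of "w \<bullet> r"] r(1) area1 by (simp add: area_def)
  \<comment> \<open>With first area \<open>t\<close>, the strip of area \<open>2 * t\<close> leaves
    \<open>t\<close> for the second quadrant, and the two halves of area 1/2 leave
    \<open>1/2 - t\<close> for each of the others.\<close>
  then have "map (\<lambda>Q. area (K \<inter> Q)) [quadrant r w (rot90 w), quadrant r (- w) (rot90 w),
      quadrant r (- w) (- rot90 w), quadrant r w (- rot90 w)] = [t, t, 1/2 - t, 1/2 - t]"
    using area_quadrants[OF lm, of w "rot90 w" r] area_quadrants(2)[OF lm, of "- w" "rot90 w" r] r w
    by simp
  moreover have "perpendicular_lines_quadrants (line r w) (line r (rot90 w))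
      [quadrant r w (rot90 w), quadrant r (- w) (rot90 w),
       quadrant r (- w) (- rot90 w), quadrant r w (- rot90 w)]"
    unfolding perpendicular_lines_quadrants_def
    using w by (intro exI[of _ r] exI[of _ w] exI[of _ "rot90 w"]) auto
  ultimately show ?thesis
    by (intro exI conjI)
qed

end
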